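(* Let $\overline{G}$ be a geometric graph with underlying abstract graph $G$, and let $\overline{G}_\times$ denote the geometric subgraph of $\overline{G}$ induced by its crossing edges. Then $\overline{G}$ is $\mathcal{C}_4$-geocolorable if and only if (1) $G \to K_2$ (i.e. $G$ is bipartite), and (2) there exists a thickness edge $2$-coloring of $\overline{G}_\times$ in which the two monochromatic subgraphs are vertex disjoint.
   Context: A geometric graph $\overline{G}$ is a finite simple graph $G$ together with a straight-line drawing of $G$ in the plane with vertices in general position (no three vertices collinear, no three edges crossing at a single point). A geometric homomorphism $f:\overline{G}\to\overline{H}$ is a map $V(\overline{G})\to V(\overline{H})$ such that whenever $uv$ is an edge of $\overline{G}$, $f(u)f(v)$ is an edge of $\overline{H}$, and whenever edges $xy$ and $uv$ cross in $\overline{G}$, the edges $f(x)f(y)$ and $f(u)f(v)$ cross in $\overline{H}$; we write $\overline{G}\to\overline{H}$ if one exists. A geometric isomorphism is a bijection such that these two implications are biconditionals. For an abstract graph $H$, the homomorphism poset $\mathcal{H}$ is the set of geometric isomorphism classes of geometric realizations (straight-line drawings in general position) of $H$, ordered by $\overline{H}_1\preceq\overline{H}_2$ iff there is a vertex-injective geometric homomorphism $\overline{H}_1\to\overline{H}_2$. A geometric graph $\overline{G}$ is $\mathcal{H}$-geocolorable iff $\overline{G}\to\overline{H}$ for some maximal element $\overline{H}\in\mathcal{H}$. Here $\mathcal{C}_4$ is the homomorphism poset of the $4$-cycle $C_4$ (its realizations are the plane $4$-cycle and the $4$-cycle drawn with exactly one crossing). The crossing edges of $\overline{G}$ are those edges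 that cross at least one other edge. A thickness edge $m$-coloring of a geometric graph is a coloring of its edges with $m$ colors such that no two edges of the same color cross; the monochromatic subgraph for a color is the (plane) subgraph formed by all edges of that color together with their endpoints. *)

theory Defs
  imports "HOL-Analysis.Analysis"
begin

record 'a sgraph =
  verts :: "'a set"
  edges :: "'a set set"

definition simple_graph :: "('a, 'z) sgraph_scheme \<Rightarrow> bool" where
  "simple_graph G \<longleftrightarrow> finite (verts G) \<and> (\<forall>e \<in> edges G. e \<subseteq> verts G \<and> card e = 2)"

definition graph_hom :: "('a \<Rightarrow> 'b) \<Rightarrow> ('a, 'y) sgraph_scheme \<Rightarrow> ('b, 'z) sgraph_scheme \<Rightarrow> bool" where
  "graph_hom f G H \<longleftrightarrow> f ` verts G \<subseteq> verts H \<and>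
     (\<forall>u v. {u, v} \<in> edges G \<longrightarrow> {f u, f v} \<in> edges H)"

definition K2 :: "nat sgraph" where
  "K2 = \<lparr>verts = {0, 1}, edges = {{0, 1}}\<rparr>"

definition C4 :: "nat sgraph" where
  "C4 = \<lparr>verts = {0, 1, 2, 3}, edges = {{0, 1}, {1, 2}, {2, 3}, {3, 0}}\<rparr>"

record 'a geom_graph = "'a sgraph" +
  pos :: "'a \<Rightarrow> real ^ 2"

definition underlying :: "'a geom_graph \<Rightarrow> 'a sgraph" where
  "underlying G = \<lparr>verts = verts G, edges = edges G\<rparr>"

text \<open>The points of the drawn edge other than its two endpoints.\<close>

definition edge_interior :: "'a geom_graph \<Rightarrow> 'a set \<Rightarrow> (real ^ 2) set" where
  "edge_interior G e = {p. \<exists>u v. e = {u, v} \<and> p \<in> open_segment (pos G u) (pos G v)}"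

definition geometric_graph :: "'a geom_graph \<Rightarrow> bool" where
  "geometric_graph G \<longleftrightarrow>
     simple_graph G \<and>
     inj_on (pos G) (verts G) \<and>
     (\<forall>u \<in> verts G. \<forall>v \<in> verts G. \<forall>w \<in> verts G.
        u \<noteq> v \<and> v \<noteq> w \<and> u \<noteq> w \<longrightarrow> \<not> collinear {pos G u, pos G v, pos G w}) \<and>
     (\<forall>d \<in> edges G. \<forall>e \<in> edges G. \<forall>f \<in> edges G.
        d \<noteq> e \<and> e \<noteq> f \<and> d \<noteq> f \<longrightarrow>
        edge_interior G d \<inter> edge_interior G e \<inter> edge_interior G f = {})"

text \<open>Because no three vertices are collinear, edges sharing an endpoint never cross, no vertex
  lies in the interior of an edge, and two edges meet in at most one interior point.\<close>

definition crosses :: "'a geom_graph \<Rightarrow> 'a set \<Rightarrow> 'a set \<Rightarrow> bool" where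
  "crosses G e f \<longleftrightarrow> e \<in> edges G \<and> f \<in> edges G \<and> e \<noteq> f \<and>
     edge_interior G e \<inter> edge_interior G f \<noteq> {}"

definition geom_hom :: "('a \<Rightarrow> 'b) \<Rightarrow> 'a geom_graph \<Rightarrow> 'b geom_graph \<Rightarrow> bool" where
  "geom_hom f G H \<longleftrightarrow> graph_hom f G H \<and>
     (\<forall>x y u v. crosses G {x, y} {u, v} \<longrightarrow> crosses H {f x, f y} {f u, f v})"

definition geom_iso :: "('a \<Rightarrow> 'b) \<Rightarrow> 'a geom_graph \<Rightarrow> 'b geom_graph \<Rightarrow> bool" where
  "geom_iso f G H \<longleftrightarrow> bij_betw f (verts G) (verts H) \<and>
     (\<forall>u \<in> verts G. \<forall>v \<in> verts G. {u, v} \<in> edges G \<longleftrightarrow> {f u, f v} \<in> edges H) \<and>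
     (\<forall>x \<in> verts G. \<forall>y \<in> verts G. \<forall>u \<in> verts G. \<forall>v \<in> verts G.
        crosses G {x, y} {u, v} \<longleftrightarrow> crosses H {f x, f y} {f u, f v})"

text \<open>A realization of \<open>H\<close> is drawn on the vertex set of \<open>H\<close> itself, so realizations differ only in
  the vertex positions; isomorphisms may still permute the vertices.\<close>

definition realizations :: "'b sgraph \<Rightarrow> 'b geom_graph set" where
  "realizations H = {R. geometric_graph R \<and> underlying R = H}"

definition iso_rel :: "'b sgraph \<Rightarrow> ('b geom_graph \<times> 'b geom_graph) set" where
  "iso_rel H = {(R, S). R \<in> realizations H \<and> S \<in> realizations H \<and> (\<exists>f. geom_iso f R S)}"

definition hom_poset :: "'b sgraph \<Rightarrow> 'b geom_graph set set" where
  "hom_poset H = realizations H // iso_rel H"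

text \<open>Order of the homomorphism poset, on isomorphism classes; by \<open>hom_le_class_iff\<close> below it does not
  depend on the chosen representatives.\<close>

definition hom_le :: "'b geom_graph set \<Rightarrow> 'b geom_graph set \<Rightarrow> bool" where
  "hom_le X Y \<longleftrightarrow> (\<exists>R \<in> X. \<exists>S \<in> Y. \<exists>f. inj_on f (verts R) \<and> geom_hom f R S)"

definition maximal_in_hom_poset :: "'b sgraph \<Rightarrow> 'b geom_graph set \<Rightarrow> bool" where
  "maximal_in_hom_poset H X \<longleftrightarrow> X \<in> hom_poset H \<and>
     (\<forall>Y \<in> hom_poset H. hom_le X Y \<longrightarrow> Y = X)"

definition geocolorable :: "'b sgraph \<Rightarrow> 'a geom_graph \<Rightarrow> bool" where
  "geocolorable H G \<longleftrightarrow> (\<exists>X. maximal_in_hom_poset H X \<and> (\<exists>R \<in> X. \<exists>f. geom_hom f G R))"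

definition edge_induced :: "'a geom_graph \<Rightarrow> 'a set set \<Rightarrow> 'a geom_graph" where
  "edge_induced G F = G\<lparr>verts := \<Union>F, edges := F\<rparr>"

definition crossing_edges :: "'a geom_graph \<Rightarrow> 'a set set" where
  "crossing_edges G = {e \<in> edges G. \<exists>f \<in> edges G. crosses G e f}"

definition crossing_subgraph :: "'a geom_graph \<Rightarrow> 'a geom_graph" where
  "crossing_subgraph G = edge_induced G (crossing_edges G)"

definition thickness_edge_coloring :: "nat \<Rightarrow> 'a geom_graph \<Rightarrow> ('a set \<Rightarrow> nat) \<Rightarrow> bool" where
  "thickness_edge_coloring m G c \<longleftrightarrow> c ` edges G \<subseteq> {..<m} \<and>
     (\<forall>e \<in> edges G. \<forall>f \<in> edges G. crosses G e f \<longrightarrow> c e \<noteq> c f)"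

definition monochromatic_subgraph :: "'a geom_graph \<Rightarrow> ('a set \<Rightarrow> nat) \<Rightarrow> nat \<Rightarrow> 'a geom_graph" where
  "monochromatic_subgraph G c i = edge_induced G {e \<in> edges G. c e = i}"

lemma geometric_graph_edgeD:
  assumes "geometric_graph G" "{u, v} \<in> edges G"
  shows "u \<in> verts G" "v \<in> verts G"
  using assms by (auto simp: geometric_graph_def simple_graph_def)

lemma geom_iso_refl: "geom_iso id G G"
  by (simp add: geom_iso_def)

lemma geom_iso_inv:
  assumes "geom_iso f G H"
  shows "geom_iso (inv_into (verts G) f) H G"
proof -
  let ?g = "inv_into (verts G) f"
  have bij: "bij_betw f (verts G) (verts H)"
    using assms by (simp add: geom_iso_def)
  have g: "?g u \<in> verts G" "f (?g u) = u" if "u \<in> verts H" for u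
    using that bij by (auto simp: bij_betw_def inv_into_into f_inv_into_f)
  have "bij_betw ?g (verts H) (verts G)"
    using bij by (rule bij_betw_inv_into)
  moreover have "{u, v} \<in> edges H \<longleftrightarrow> {?g u, ?g v} \<in> edges G"
    if "u \<in> verts H" "v \<in> verts H" for u v
    using assms g[OF that(1)] g[OF that(2)] unfolding geom_iso_def by metis
  moreover have "crosses H {x, y} {u, v} \<longleftrightarrow> crosses G {?g x, ?g y} {?g u, ?g v}"
    if "x \<in> verts H" "y \<in> verts H" "u \<in> verts H" "v \<in> verts H" for x y u v
    using assms g[OF that(1)] g[OF that(2)] g[OF that(3)] g[OF that(4)]
    unfolding geom_iso_def by metis
  ultimately show ?thesis
    by (simp add: geom_iso_def)
qed

lemma geom_iso_comp:
  assumes "geom_iso f G H" "geom_iso g H K"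
  shows "geom_iso (g \<circ> f) G K"
proof -
  have "f u \<in> verts H" if "u \<in> verts G" for u
    using that assms(1) by (auto simp: geom_iso_def bij_betw_def)
  then show ?thesis
    using assms by (auto simp: geom_iso_def intro: bij_betw_trans)
qed

lemma equiv_iso_rel: "equiv (realizations H) (iso_rel H)"
proof (rule equivI)
  show "iso_rel H \<subseteq> realizations H \<times> realizations H"
    by (auto simp: iso_rel_def)
  show "refl_on (realizations H) (iso_rel H)"
    using geom_iso_refl by (auto simp: refl_on_def iso_rel_def)
  show "sym (iso_rel H)"
    using geom_iso_inv by (fastforce simp: sym_def iso_rel_def)
  show "trans (iso_rel H)"
    using geom_iso_comp by (fastforce simp: trans_def iso_rel_def)
qed

lemma geom_hom_if_geom_iso:
  assumes "geometric_graph G" "geom_iso f G H"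
  shows "geom_hom f G H"
proof -
  have "crosses H {f x, f y} {f u, f v}" if "crosses G {x, y} {u, v}" for x y u v
  proof -
    have "{x, y} \<in> edges G" "{u, v} \<in> edges G"
      using that by (auto simp: crosses_def)
    then have "x \<in> verts G" "y \<in> verts G" "u \<in> verts G" "v \<in> verts G"
      using geometric_graph_edgeD[OF assms(1)] by blast+
    then show ?thesis
      using assms(2) that by (simp add: geom_iso_def)
  qed
  moreover have "{f u, f v} \<in> edges H" if "{u, v} \<in> edges G" for u v
    using assms(2) that geometric_graph_edgeD[OF assms(1) that] by (simp add: geom_iso_def)
  ultimately show ?thesis
    using assms(2) by (simp add: geom_hom_def graph_hom_def geom_iso_def bij_betw_def)
qed

lemma geom_hom_comp:
  assumes "geom_hom f G H" "geom_hom g H K"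
  shows "geom_hom (g \<circ> f) G K"
  using assms by (auto simp: geom_hom_def graph_hom_def)

lemma hom_le_class_iff:
  assumes "R \<in> realizations H" "S \<in> realizations H"
  shows "hom_le (iso_rel H `` {R}) (iso_rel H `` {S}) \<longleftrightarrow>
    (\<exists>f. inj_on f (verts R) \<and> geom_hom f R S)"
proof
  assume "hom_le (iso_rel H `` {R}) (iso_rel H `` {S})"
  then obtain R' S' f where mem: "(R, R') \<in> iso_rel H" "(S, S') \<in> iso_rel H"
    and f: "inj_on f (verts R')" "geom_hom f R' S'"
    by (auto simp: hom_le_def)
  from mem obtain g k where R': "geom_iso g R R'" and S': "geom_iso k S S'"
    and real: "S' \<in> realizations H"
    by (auto simp: iso_rel_def)
  let ?k = "inv_into (verts S) k"
  have k: "geom_iso ?k S' S"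
    using S' by (rule geom_iso_inv)
  have "geom_hom (?k \<circ> (f \<circ> g)) R S"
    using geom_hom_if_geom_iso[OF _ R'] geom_hom_if_geom_iso[OF _ k] assms(1) real f(2)
    by (auto simp: realizations_def intro!: geom_hom_comp)
  moreover have "inj_on (?k \<circ> (f \<circ> g)) (verts R)"
  proof (intro comp_inj_on)
    show "inj_on g (verts R)" "inj_on f (g ` verts R)"
      using R' f(1) by (auto simp: geom_iso_def bij_betw_def)
    have "(f \<circ> g) ` verts R \<subseteq> verts S'"
      using R' f(2) by (auto simp: geom_iso_def bij_betw_def geom_hom_def graph_hom_def)
    then show "inj_on ?k ((f \<circ> g) ` verts R)"
      using k by (auto simp: geom_iso_def bij_betw_def intro: inj_on_subset)
  qed
  ultimately show "\<exists>f. inj_on f (verts R) \<and> geom_hom f R S"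
    by blast
next
  assume "\<exists>f. inj_on f (verts R) \<and> geom_hom f R S"
  moreover have "R \<in> iso_rel H `` {R}" "S \<in> iso_rel H `` {S}"
    using assms geom_iso_refl by (auto simp: iso_rel_def)
  ultimately show "hom_le (iso_rel H `` {R}) (iso_rel H `` {S})"
    unfolding hom_le_def by blast
qed

end

theory Submission
  imports Defs
begin

text \<open>All realizations of the 4-cycle map injectively to a crossed one, in which exactly one pair of
  opposite sides crosses; hence the crossed realizations form the only maximal class.  A homomorphism
  to a crossed 4-cycle is a map to \<open>C4 = K\<^bsub>2,2\<^esub>\<close> that sends each crossing pair to the two
  crossing sides, so its parity is a bipartition and its side is the colour of a crossing edge.\<close>

section \<open>Segments and crossings\<close>

lemma edge_interior_doubleton [simp]:
  "edge_interior G {u, v} = open_segment (pos G u) (pos G v)"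
  by (auto simp: edge_interior_def doubleton_eq_iff open_segment_commute)

text \<open>A common point gives \<open>s (b - a) = t (c - a)\<close> with \<open>s\<close>
  positive; dividing by \<open>s\<close> puts \<open>b\<close> on the line through \<open>a\<close>
  and \<open>c\<close>.\<close>

lemma open_segments_common_endpoint_disjoint:
  fixes a b c :: "'a::real_normed_vector"
  assumes "\<not> collinear {a, b, c}"
  shows "open_segment a b \<inter> open_segment a c = {}"
proof (rule ccontr)
  assume "open_segment a b \<inter> open_segment a c \<noteq> {}"
  then obtain s t where s: "0 < s" and eq: "(1 - s) *\<^sub>R a + s *\<^sub>R b = (1 - t) *\<^sub>R a + t *\<^sub>R c"
    by (auto simp: in_segment)
  have "s *\<^sub>R b = (s - t) *\<^sub>R a + t *\<^sub>R c"
  proof -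
    have "s *\<^sub>R b = ((1 - s) *\<^sub>R a + s *\<^sub>R b) - (1 - s) *\<^sub>R a"
      by simp
    also have "\<dots> = (s - t) *\<^sub>R a + t *\<^sub>R c"
      unfolding eq by (simp add: algebra_simps)
    finally show ?thesis .
  qed
  moreover have "b = (1 / s) *\<^sub>R (s *\<^sub>R b)"
    using s by simp
  ultimately have "b = (1 / s) *\<^sub>R ((s - t) *\<^sub>R a + t *\<^sub>R c)"
    by simp
  then have "b = (1 - t / s) *\<^sub>R a + (1 - (1 - t / s)) *\<^sub>R c"
    using s by (simp add: scaleR_add_right diff_divide_distrib)
  then have "collinear {a, b, c}"
    unfolding collinear_3_expand by blast
  with assms show False by blast
qed

text \<open>Applied to the four sides of a closed quadrilateral \<open>a b c d\<close>, this rules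
  out drawings of the 4-cycle with two crossings.\<close>

lemma open_segments_not_both_opposite_pairs_meet:
  fixes a b c d :: "'a::real_normed_vector"
  assumes "\<not> collinear {a, b, c}"
    and "open_segment a b \<inter> open_segment c d \<noteq> {}"
  shows "open_segment b c \<inter> open_segment d a = {}"
proof (rule ccontr)
  assume "open_segment b c \<inter> open_segment d a \<noteq> {}"
  then obtain u w where u: "0 < u" "u < 1" and w: "0 < w" "w < 1"
    and bc: "(1 - u) *\<^sub>R b + u *\<^sub>R c = (1 - w) *\<^sub>R d + w *\<^sub>R a"
    by (auto simp: in_segment)
  from assms(2) obtain s t where s: "0 < s" "s < 1" and t: "0 < t" "t < 1"
    and ab: "(1 - s) *\<^sub>R a + s *\<^sub>R b = (1 - t) *\<^sub>R c + t *\<^sub>R d"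
    by (auto simp: in_segment)
  \<comment> \<open>After the \<open>d\<close> terms cancel, \<open>p\<close> is the total
    coefficient of \<open>c\<close> and \<open>q\<close> that of \<open>a\<close>. Coefficients on
    the two sides have equal sums, so \<open>b\<close> gets \<open>p - q\<close>; positivity of
    \<open>p\<close> permits the division.\<close>
  define p where "p = (1 - t) * (1 - w) + t * u"
  define q where "q = (1 - s) * (1 - w) + t * w"
  have p: "0 < p"
    using t u w by (simp add: p_def add_pos_pos)
  \<comment> \<open>Eliminating \<open>d\<close> from the two relations expresses \<open>c\<close> as an affine combination of \<open>a\<close> and \<open>b\<close>.\<close>
  have "(1 - w) *\<^sub>R ((1 - s) *\<^sub>R a + s *\<^sub>R b) + t *\<^sub>R ((1 - w) *\<^sub>R d + w *\<^sub>R a) =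
      (1 - w) *\<^sub>R ((1 - t) *\<^sub>R c + t *\<^sub>R d) + t *\<^sub>R ((1 - u) *\<^sub>R b + u *\<^sub>R c)"
    unfolding ab bc ..
  then have "p *\<^sub>R c = q *\<^sub>R a + (p - q) *\<^sub>R b"
    unfolding p_def q_def by (simp add: algebra_simps)
  moreover have "c = (1 / p) *\<^sub>R (p *\<^sub>R c)"
    using p by simp
  ultimately have "c = (1 / p) *\<^sub>R (q *\<^sub>R a + (p - q) *\<^sub>R b)"
    by simp
  then have "c = (q / p) *\<^sub>R a + (1 - q / p) *\<^sub>R b"
    using p by (simp add: scaleR_add_right diff_divide_distrib)
  then have "collinear {a, c, b}"
    unfolding collinear_3_expand by blast
  with assms(1) show False by (simp add: insert_commute)
qed

text \<open>The cross product of \<open>b - a\<close> and \<open>c - a\<close> vanishes. For points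
  with numerical coordinates this reduces noncollinearity to arithmetic.\<close>

lemma collinear_det_zero:
  fixes a b c :: "real ^ 2"
  assumes "collinear {a, b, c}"
  shows "(b $ 1 - a $ 1) * (c $ 2 - a $ 2) = (b $ 2 - a $ 2) * (c $ 1 - a $ 1)"
\<comment> \<open>\<open>collinear_3_expand\<close> keeps \<open>a = c\<close> as a separate
  alternative; there both sides are zero.\<close>
proof (cases "a = c")
  case False
  then obtain u where "b = u *\<^sub>R a + (1 - u) *\<^sub>R c"
    using assms unfolding collinear_3_expand by blast
  then have b: "b $ i = u * a $ i + (1 - u) * c $ i" for i
    by simp
  show ?thesis
    unfolding b by (simp add: algebra_simps)
qed simp

section \<open>Crossings in a geometric graph and in its crossing subgraph\<close>

lemma geometric_graph_adjacent_not_cross: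
  assumes G: "geometric_graph G"
  shows "\<not> crosses G {u, v} {u, w}"
proof
  assume cr: "crosses G {u, v} {u, w}"
  then have e: "{u, v} \<in> edges G" "{u, w} \<in> edges G" and "v \<noteq> w"
    and meet: "open_segment (pos G u) (pos G v) \<inter> open_segment (pos G u) (pos G w) \<noteq> {}"
    by (auto simp: crosses_def)
  have "u \<noteq> v" "u \<noteq> w"
    using G e by (auto simp: geometric_graph_def simple_graph_def)
  moreover have "u \<in> verts G" "v \<in> verts G" "w \<in> verts G"
    using geometric_graph_edgeD[OF G] e by blast+
  ultimately have "\<not> collinear {pos G u, pos G v, pos G w}"
    using \<open>v \<noteq> w\<close> G by (simp add: geometric_graph_def)
  from open_segments_common_endpoint_disjoint[OF this] meet show False by blast
qed

lemma crosses_sym: "crosses G e f \<longleftrightarrow> crosses G f e"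
  by (auto simp: crosses_def)

lemma edge_interior_crossing_subgraph [simp]:
  "edge_interior (crossing_subgraph G) = edge_interior G"
  by (simp add: fun_eq_iff edge_interior_def crossing_subgraph_def edge_induced_def)

lemma edges_crossing_subgraph: "edges (crossing_subgraph G) = {e. \<exists>f. crosses G e f}"
proof -
  have "e \<in> edges G \<and> f \<in> edges G" if "crosses G e f" for e f
    using that by (simp add: crosses_def)
  then show ?thesis
    by (auto simp: crossing_subgraph_def edge_induced_def crossing_edges_def)
qed

text \<open>Both edges of a crossing pair are crossing edges, so discarding the remaining edges
  loses no crossing.\<close>

lemma crosses_crossing_subgraph [simp]: "crosses (crossing_subgraph G) e f \<longleftrightarrow> crosses G e f"
proof -
  have "crosses (crossing_subgraph G) e f \<longleftrightarrow>
      (\<exists>d. crosses G e d) \<and> (\<exists>d. crosses G f d) \<and> e \<noteq> f \<and>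
      edge_interior G e \<inter> edge_interior G f \<noteq> {}"
    by (simp add: crosses_def[of "crossing_subgraph G"] edges_crossing_subgraph)
  also have "\<dots> \<longleftrightarrow> crosses G e f"
    using crosses_sym[of G e f] by (metis crosses_def)
  finally show ?thesis .
qed

lemma simple_graph_edgeE:
  assumes "simple_graph G" "e \<in> edges G"
  obtains u v where "e = {u, v}"
  using assms by (auto simp: simple_graph_def card_2_iff)

section \<open>Realizations of the 4-cycle\<close>

text \<open>The vertices 0, 1, 2, 3 sit at (0,0), (1,1), (1,0), (0,1): edges \<open>{0, 1}\<close>
  and \<open>{2, 3}\<close> are the diagonals of the unit square, \<open>{1, 2}\<close> and
  \<open>{3, 0}\<close> its vertical sides.\<close>

definition crossed_C4 :: "nat geom_graph" where
  "crossed_C4 = \<lparr>verts = {0, 1, 2, 3}, edges = {{0, 1}, {1, 2}, {2, 3}, {3, 0}},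
     pos = (\<lambda>i. vector [if i = 1 \<or> i = 2 then 1 else 0, if i = 1 \<or> i = 3 then 1 else 0])\<rparr>"

lemma crossed_C4_noncollinear:
  assumes "u \<in> {0, 1, 2, 3}" "v \<in> {0, 1, 2, 3}" "w \<in> {0, 1, 2, 3}" "u \<noteq> v" "v \<noteq> w" "u \<noteq> w"
  shows "\<not> collinear {pos crossed_C4 u, pos crossed_C4 v, pos crossed_C4 w}"
  using assms by (auto dest!: collinear_det_zero simp: crossed_C4_def)

text \<open>A 4-cycle has no three pairwise nonadjacent vertices. It is applied with the edges of
  \<open>C4\<close> as vertices, since consecutive edges again form a 4-cycle.\<close>

lemma four_cycle_three_edges_adjacent:
  assumes "symp N" "N a b" "N b c" "N c d" "N d a"
    and "x \<in> {a, b, c, d}" "y \<in> {a, b, c, d}" "z \<in> {a, b, c, d}" "x \<noteq> y" "y \<noteq> z" "x \<noteq> z"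
  shows "N x y \<or> N y z \<or> N x z"
proof -
  have "N b a" "N c b" "N d c" "N a d"
    using assms(1-5) by (auto dest: sympD)
  with assms(2-) show ?thesis
    by (elim insertE emptyE; simp)
qed

lemma geometric_graph_crossed_C4: "geometric_graph crossed_C4"
proof -
  define I where "I = edge_interior crossed_C4"
  have disj: "I {u, v} \<inter> I {u, w} = {}"
    if "u \<in> {0, 1, 2, 3}" "v \<in> {0, 1, 2, 3}" "w \<in> {0, 1, 2, 3}" "u \<noteq> v" "v \<noteq> w" "u \<noteq> w" for u v w
    using open_segments_common_endpoint_disjoint[OF crossed_C4_noncollinear[OF that]]
    by (simp add: I_def)
  \<comment> \<open>The common endpoint is written first to match \<open>disj\<close>; the next step
    restores the usual order.\<close>
  have "I {1, 0} \<inter> I {1, 2} = {}" "I {2, 1} \<inter> I {2, 3} = {}"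
    "I {3, 2} \<inter> I {3, 0} = {}" "I {0, 3} \<inter> I {0, 1} = {}"
    by (rule disj; simp)+
  then have adj: "I {0, 1} \<inter> I {1, 2} = {}" "I {1, 2} \<inter> I {2, 3} = {}"
    "I {2, 3} \<inter> I {3, 0} = {}" "I {3, 0} \<inter> I {0, 1} = {}"
    by (simp_all add: insert_commute)
  \<comment> \<open>Among three distinct edges two are consecutive and have disjoint interiors, so
    no point lies on all three.\<close>
  have "I d \<inter> I e \<inter> I f = {}"
    if "d \<in> edges crossed_C4" "e \<in> edges crossed_C4" "f \<in> edges crossed_C4"
      "d \<noteq> e" "e \<noteq> f" "d \<noteq> f" for d e f
  proof -
    have ed: "edges crossed_C4 = {{0, 1}, {1, 2}, {2, 3}, {3, 0}}"
      by (simp add: crossed_C4_def)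
    have "symp (\<lambda>d e. I d \<inter> I e = {})"
      by (simp add: symp_def Int_commute)
    from four_cycle_three_edges_adjacent[OF this adj that(1-3)[unfolded ed] that(4-6)]
    show ?thesis by blast
  qed
  moreover have "inj_on (pos crossed_C4) (verts crossed_C4)"
    by (auto simp: inj_on_def crossed_C4_def vec_eq_iff forall_2)
  moreover have "simple_graph crossed_C4"
    by (auto simp: simple_graph_def crossed_C4_def)
  moreover have "verts crossed_C4 = {0, 1, 2, 3}"
    by (simp add: crossed_C4_def)
  ultimately show ?thesis
    using crossed_C4_noncollinear unfolding geometric_graph_def I_def by simp
qed

lemma crossed_C4_realization: "crossed_C4 \<in> realizations C4"
  using geometric_graph_crossed_C4
  by (simp add: realizations_def underlying_def C4_def crossed_C4_def)

lemma realizations_C4D: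
  assumes "R \<in> realizations C4"
  shows "geometric_graph R" "verts R = {0, 1, 2, 3}" "edges R = {{0, 1}, {1, 2}, {2, 3}, {3, 0}}"
  using assms by (auto simp: realizations_def underlying_def C4_def)

text \<open>Only the two diagonals of a 4-cycle escape \<open>N\<close>. With edges as vertices and
  \<open>N\<close> read as not crossing, the diagonals are the pairs of opposite edges.\<close>

lemma four_cycle_nonadjacent:
  assumes "symp N" "N a b" "N b c" "N c d" "N d a"
    and "x \<in> {a, b, c, d}" "y \<in> {a, b, c, d}" "x \<noteq> y" "\<not> N x y"
  shows "{x, y} = {a, c} \<or> {x, y} = {b, d}"
proof -
  have "N b a" "N c b" "N d c" "N a d"
    using assms(1-5) by (auto dest: sympD)
  with assms(2-) show ?thesis
    by (elim insertE emptyE; simp add: insert_commute)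
qed

lemma C4_crosses_opposite:
  assumes R: "R \<in> realizations C4" and cr: "crosses R e f"
  shows "{e, f} = {{0, 1}, {2, 3}} \<or> {e, f} = {{1, 2}, {3, 0}}"
proof -
  have adj: "\<not> crosses R {u, v} {u, w}" for u v w
    using realizations_C4D(1)[OF R] by (rule geometric_graph_adjacent_not_cross)
  have N: "\<not> crosses R {0, 1} {1, 2}" "\<not> crosses R {1, 2} {2, 3}"
    "\<not> crosses R {2, 3} {3, 0}" "\<not> crosses R {3, 0} {0, 1}"
    using adj[of 1 0 2] adj[of 2 1 3] adj[of 3 2 0] adj[of 0 3 1] by (simp_all add: insert_commute)
  have sym: "symp (\<lambda>d e. \<not> crosses R d e)"
    using crosses_sym by (auto simp: symp_def)
  \<comment> \<open>The double negation has the shape of the premise that \<open>N\<close> fails,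
    \<open>N\<close> itself being a negated crossing.\<close>
  have "e \<in> edges R" "f \<in> edges R" "e \<noteq> f" "\<not> \<not> crosses R e f"
    using cr by (simp_all add: crosses_def)
  from four_cycle_nonadjacent[where N = "\<lambda>d e. \<not> crosses R d e", OF sym N
      this[unfolded realizations_C4D(3)[OF R]]]
  show ?thesis .
qed

lemma C4_not_both_opposite_pairs_cross:
  assumes "R \<in> realizations C4" "crosses R {0, 1} {2, 3}"
  shows "\<not> crosses R {1, 2} {3, 0}"
proof -
  have "\<not> collinear {pos R 0, pos R 1, pos R 2}"
    using realizations_C4D[OF assms(1)] by (auto simp: geometric_graph_def)
  then show ?thesis
    using open_segments_not_both_opposite_pairs_meet assms(2) by (fastforce simp: crosses_def)
qed

lemma crosses_crossed_C4_iff: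
  "crosses crossed_C4 e f \<longleftrightarrow> {e, f} = {{0, 1}, {2, 3}}"
proof -
  let ?P = "pos crossed_C4"
  \<comment> \<open>The diagonals meet at the centre of the square.\<close>
  have "(vector [1/2, 1/2] :: real ^ 2) \<in> open_segment (?P 0) (?P 1)"
    "(vector [1/2, 1/2] :: real ^ 2) \<in> open_segment (?P 2) (?P 3)"
    by (auto simp: in_segment crossed_C4_def vec_eq_iff forall_2 intro!: exI[of _ "1/2"])
  then have "edge_interior crossed_C4 {0, 1} \<inter> edge_interior crossed_C4 {2, 3} \<noteq> {}"
    by auto
  then have cr: "crosses crossed_C4 {0, 1} {2, 3}"
    by (auto simp: crosses_def crossed_C4_def doubleton_eq_iff)
  note no = C4_not_both_opposite_pairs_cross[OF crossed_C4_realization cr]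
  show ?thesis
  proof
    assume "crosses crossed_C4 e f"
    then show "{e, f} = {{0, 1}, {2, 3}}"
      using C4_crosses_opposite[OF crossed_C4_realization, of e f] no
      by (auto simp: doubleton_eq_iff[of e f] crosses_sym)
  next
    assume "{e, f} = {{0, 1}, {2, 3}}"
    then show "crosses crossed_C4 e f"
      using cr by (auto simp: doubleton_eq_iff[of e f] crosses_sym)
  qed
qed

text \<open>Exactly one pair of opposite edges crosses in \<open>R\<close>, and a rotation of the
  cycle moves it onto the crossing pair of \<open>crossed_C4\<close>.\<close>

lemma C4_geom_iso_crossed:
  assumes R: "R \<in> realizations C4" and cr: "crosses R e f"
  shows "\<exists>g. geom_iso g R crossed_C4"
proof -
  note RD = realizations_C4D[OF R]
  have ed: "edges crossed_C4 = {{0, 1}, {1, 2}, {2, 3}, {3, 0}}" and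
    ve: "verts crossed_C4 = {0, 1, 2, 3}"
    by (simp_all add: crossed_C4_def)
  consider "crosses R {0, 1} {2, 3}" | "crosses R {1, 2} {3, 0}"
    using C4_crosses_opposite[OF R cr] cr by (auto simp: doubleton_eq_iff[of e f] crosses_sym)
  then show ?thesis
  proof cases
    case 1
    have "crosses R d k \<longleftrightarrow> {d, k} = {{0, 1}, {2, 3}}" for d k
      using C4_crosses_opposite[OF R, of d k] C4_not_both_opposite_pairs_cross[OF R 1] 1
      by (auto simp: doubleton_eq_iff[of d k] crosses_sym)
    then have "geom_iso id R crossed_C4"
      using RD ed ve by (simp add: geom_iso_def crosses_crossed_C4_iff)
    then show ?thesis by blast
  next
    case 2
    \<comment> \<open>Rotation by one step backwards, written with \<open>+ 3\<close> to avoid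
      truncated subtraction; it takes \<open>{1, 2}\<close> to \<open>{0, 1}\<close> and
      \<open>{3, 0}\<close> to \<open>{2, 3}\<close>.\<close>
    let ?r = "\<lambda>i::nat. (i + 3) mod 4"
    have no: "\<not> crosses R {0, 1} {2, 3}"
      using C4_not_both_opposite_pairs_cross[OF R] 2 by blast
    have c: "crosses R d k \<longleftrightarrow> {d, k} = {{1, 2}, {3, 0}}" for d k
      using C4_crosses_opposite[OF R, of d k] no 2
      by (auto simp: doubleton_eq_iff[of d k] crosses_sym)
    have bij: "bij_betw ?r {0, 1, 2, 3} {0, 1, 2, 3}"
      by (auto simp: bij_betw_def inj_on_def)
    have edge: "\<forall>u\<in>{0, 1, 2, 3}. \<forall>v\<in>{0, 1, 2, 3}.
        {u, v} \<in> {{0, 1}, {1, 2}, {2, 3}, {3, 0}} \<longleftrightarrow>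
        {?r u, ?r v} \<in> {{0, 1}, {1, 2}, {2, 3}, {3, 0}}"
      by (simp add: doubleton_eq_iff)
    have sides: "{u, v} = {1, 2} \<longleftrightarrow> {?r u, ?r v} = {0, 1}"
      "{u, v} = {3, 0} \<longleftrightarrow> {?r u, ?r v} = {2, 3}"
      if "u \<in> {0, 1, 2, 3}" "v \<in> {0, 1, 2, 3}" for u v
      using that by (elim insertE emptyE; simp add: doubleton_eq_iff)+
    have crosses: "crosses R {x, y} {u, v} \<longleftrightarrow> crosses crossed_C4 {?r x, ?r y} {?r u, ?r v}"
      if "x \<in> {0, 1, 2, 3}" "y \<in> {0, 1, 2, 3}" "u \<in> {0, 1, 2, 3}" "v \<in> {0, 1, 2, 3}" for x y u v
      unfolding c crosses_crossed_C4_iff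
        doubleton_eq_iff[of "{x, y}" "{u, v}"] doubleton_eq_iff[of "{?r x, ?r y}" "{?r u, ?r v}"]
        sides[OF that(1,2)] sides[OF that(3,4)] ..
    have "geom_iso ?r R crossed_C4"
      unfolding geom_iso_def RD(2,3) ed ve by (intro conjI bij edge ballI crosses)
    then show ?thesis by blast
  qed
qed

section \<open>The maximal class and geocolorability\<close>

lemma C4_hom_crossed:
  assumes R: "R \<in> realizations C4"
  shows "\<exists>g. inj_on g (verts R) \<and> geom_hom g R crossed_C4"
proof (cases "\<exists>e f. crosses R e f")
  case True
  then obtain g where "geom_iso g R crossed_C4"
    using C4_geom_iso_crossed[OF R] by blast
  then show ?thesis
    using geom_hom_if_geom_iso realizations_C4D(1)[OF R] by (auto simp: geom_iso_def bij_betw_def)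
next
  case False
  \<comment> \<open>A plane drawing has no crossing to preserve, and both drawings have the same
    edges.\<close>
  then have "geom_hom id R crossed_C4"
    using realizations_C4D[OF R] by (simp add: geom_hom_def graph_hom_def crossed_C4_def)
  then show ?thesis
    using inj_on_id by blast
qed

text \<open>Every class lies below the crossed one, which forces uniqueness. Conversely, anything
  above the crossed class contains a crossing and is therefore isomorphic to it.\<close>

lemma maximal_C4_iff: "maximal_in_hom_poset C4 X \<longleftrightarrow> X = iso_rel C4 `` {crossed_C4}"
proof
  have crossed: "iso_rel C4 `` {crossed_C4} \<in> hom_poset C4"
    unfolding hom_poset_def using crossed_C4_realization by (rule quotientI)
  {
    assume X: "maximal_in_hom_poset C4 X"
    then obtain R where R: "R \<in> realizations C4" "X = iso_rel C4 `` {R}"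
      by (auto simp: maximal_in_hom_poset_def hom_poset_def elim: quotientE)
    then have "hom_le X (iso_rel C4 `` {crossed_C4})"
      using C4_hom_crossed hom_le_class_iff crossed_C4_realization by blast
    then show "X = iso_rel C4 `` {crossed_C4}"
      using X crossed by (auto simp: maximal_in_hom_poset_def)
  }
  assume X: "X = iso_rel C4 `` {crossed_C4}"
  have "Y = X" if Y: "Y \<in> hom_poset C4" and le: "hom_le X Y" for Y
  proof -
    obtain S where S: "S \<in> realizations C4" "Y = iso_rel C4 `` {S}"
      using Y by (auto simp: hom_poset_def elim: quotientE)
    then obtain f where "geom_hom f crossed_C4 S"
      using le X hom_le_class_iff crossed_C4_realization by blast
    \<comment> \<open>The homomorphism transports this crossing into \<open>S\<close>, making
      \<open>S\<close> a crossed realization.\<close>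
    moreover have "crosses crossed_C4 {0, 1} {2, 3}"
      by (simp add: crosses_crossed_C4_iff)
    ultimately have "crosses S {f 0, f 1} {f 2, f 3}"
      by (simp add: geom_hom_def)
    then have "(S, crossed_C4) \<in> iso_rel C4"
      using C4_geom_iso_crossed[OF S(1)] S(1) crossed_C4_realization by (auto simp: iso_rel_def)
    then show ?thesis
      using equiv_class_eq[OF equiv_iso_rel] S(2) X by blast
  qed
  then show "maximal_in_hom_poset C4 X"
    using crossed X by (simp add: maximal_in_hom_poset_def)
qed

lemma geocolorable_C4_iff: "geocolorable C4 G \<longleftrightarrow> (\<exists>f. geom_hom f G crossed_C4)"
proof
  assume "geocolorable C4 G"
  then obtain R f where R: "R \<in> realizations C4" and f: "geom_hom f G R"
    by (auto simp: geocolorable_def maximal_C4_iff iso_rel_def)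
  from C4_hom_crossed[OF R] f show "\<exists>f. geom_hom f G crossed_C4"
    using geom_hom_comp by blast
next
  assume "\<exists>f. geom_hom f G crossed_C4"
  moreover have "crossed_C4 \<in> iso_rel C4 `` {crossed_C4}"
    using crossed_C4_realization geom_iso_refl by (auto simp: iso_rel_def)
  ultimately show "geocolorable C4 G"
    by (auto simp: geocolorable_def maximal_C4_iff)
qed

section \<open>Colourings and homomorphisms\<close>

text \<open>This is \<open>C4\<close> seen as the complete bipartite graph on the parts
  \<open>{0, 2}\<close> and \<open>{1, 3}\<close>: preserving edges only requires changing
  parity.\<close>

lemma C4_edge_iff_parity:
  fixes i j :: nat
  assumes "i < 4" "j < 4"
  shows "{i, j} \<in> {{0, 1}, {1, 2}, {2, 3}, {3, 0}} \<longleftrightarrow> even i \<noteq> even j"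
proof -
  have "i \<in> {0, 1, 2, 3}" "j \<in> {0, 1, 2, 3}"
    using assms by auto
  then show ?thesis
    by (elim insertE emptyE; simp add: doubleton_eq_iff)
qed

lemma verts_crossed_C4: "verts crossed_C4 = {..<4}"
  and edges_crossed_C4: "edges crossed_C4 = {{0, 1}, {1, 2}, {2, 3}, {3, 0}}"
  by (auto simp: crossed_C4_def)

lemma bipartite_if_hom_crossed_C4:
  assumes G: "geometric_graph G" and f: "geom_hom f G crossed_C4"
  shows "graph_hom (\<lambda>v. f v mod 2) (underlying G) K2"
  unfolding graph_hom_def underlying_def K2_def
proof (clarsimp, intro conjI allI impI)
  fix u v assume e: "{u, v} \<in> edges G"
  then have "f u < 4" "f v < 4" "{f u, f v} \<in> edges crossed_C4"
    using f geometric_graph_edgeD[OF G e] by (auto simp: geom_hom_def graph_hom_def verts_crossed_C4)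
  then have "even (f u) \<noteq> even (f v)"
    using C4_edge_iff_parity by (simp add: edges_crossed_C4)
  then show "{f u mod 2, f v mod 2} = {0, Suc 0}"
    by (auto simp: even_iff_mod_2_eq_zero odd_iff_mod_2_eq_one)
qed auto

text \<open>An edge is coloured by the diagonal onto which it is mapped; on crossing edges the
  \<open>else\<close> branch means image \<open>{2, 3}\<close>. A vertex shared by both colours
  would have its image in both of the disjoint diagonals.\<close>

lemma coloring_if_hom_crossed_C4:
  assumes G: "geometric_graph G" and f: "geom_hom f G crossed_C4"
  defines "c \<equiv> \<lambda>e. if f ` e = {0, 1} then 0 else 1 :: nat"
  shows "thickness_edge_coloring 2 (crossing_subgraph G) c"
    and "verts (monochromatic_subgraph (crossing_subgraph G) c 0) \<inter>
      verts (monochromatic_subgraph (crossing_subgraph G) c 1) = {}"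
proof -
  \<comment> \<open>The only crossing available in the target is between its diagonals, so a
    crossing pair covers both, in one order or the other.\<close>
  have images: "f ` d = {0, 1} \<and> f ` e = {2, 3} \<or> f ` d = {2, 3} \<and> f ` e = {0, 1}"
    if "crosses G d e" for d e
  proof -
    have "simple_graph G"
      using G by (simp add: geometric_graph_def)
    moreover have "d \<in> edges G" "e \<in> edges G"
      using that by (simp_all add: crosses_def)
    ultimately obtain x y u v where de: "d = {x, y}" "e = {u, v}"
      by (metis simple_graph_edgeE)
    have "crosses crossed_C4 {f x, f y} {f u, f v}"
      using f that unfolding geom_hom_def de by blast
    then show ?thesis
      unfolding crosses_crossed_C4_iff de image_insert image_empty
        doubleton_eq_iff[of "{f x, f y}" "{f u, f v}"] .
  qed
  have ne: "{2, 3} \<noteq> {0, 1 :: nat}"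
    by (auto simp: doubleton_eq_iff)
  have "c e < 2" for e
    by (simp add: c_def)
  moreover have "c d \<noteq> c e" if "crosses G d e" for d e
    using images[OF that]
  proof (elim disjE conjE)
    assume "f ` d = {0, 1}" "f ` e = {2, 3}"
    with ne show ?thesis by (simp only: c_def if_True if_False) simp
  next
    assume "f ` d = {2, 3}" "f ` e = {0, 1}"
    with ne show ?thesis by (simp only: c_def if_True if_False) simp
  qed
  ultimately show "thickness_edge_coloring 2 (crossing_subgraph G) c"
    by (simp add: thickness_edge_coloring_def image_subset_iff)
  have two: "f ` e = {0, 1} \<or> f ` e = {2, 3}" if "e \<in> edges (crossing_subgraph G)" for e
  proof -
    from that obtain d where "crosses G e d"
      by (auto simp: edges_crossing_subgraph)
    from images[OF this] show ?thesis by metis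
  qed
  have "d \<inter> e = {}"
    if "d \<in> edges (crossing_subgraph G)" "e \<in> edges (crossing_subgraph G)" "c d = 0" "c e = 1" for d e
  proof -
    have "f ` d = {0, 1}" "f ` e \<noteq> {0, 1}"
      using that(3,4) unfolding c_def by (metis zero_neq_one)+
    moreover from this(2) two[OF that(2)] have "f ` e = {2, 3}" by metis
    moreover have "{0, 1} \<inter> {2, 3 :: nat} = {}"
      by simp
    ultimately show ?thesis by blast
  qed
  then show "verts (monochromatic_subgraph (crossing_subgraph G) c 0) \<inter>
      verts (monochromatic_subgraph (crossing_subgraph G) c 1) = {}"
    unfolding monochromatic_subgraph_def edge_induced_def by fastforce
qed

lemma hom_crossed_C4_if_coloring:
  assumes G: "geometric_graph G" and h: "graph_hom h (underlying G) K2"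
    and c: "thickness_edge_coloring 2 (crossing_subgraph G) c"
    and disj: "verts (monochromatic_subgraph (crossing_subgraph G) c 0) \<inter>
      verts (monochromatic_subgraph (crossing_subgraph G) c 1) = {}"
  shows "\<exists>f. geom_hom f G crossed_C4"
proof -
  define V where "V i = verts (monochromatic_subgraph (crossing_subgraph G) c i)" for i
  have V_sub: "e \<subseteq> V (c e)" if "crosses G e d" for e d
    using that by (auto simp: V_def monochromatic_subgraph_def edge_induced_def edges_crossing_subgraph)
  \<comment> \<open>The bipartition \<open>h\<close> fixes the parity and the colour class fixes the
    diagonal. Vertices on no crossing edge default to offset 0; the even offset keeps every edge
    between opposite parities.\<close>
  define f where "f v = h v + (if v \<in> V 1 then 2 else 0)" for v
  have h_edge: "{h u, h v} = {0, 1}" if "{u, v} \<in> edges G" for u v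
    using h that by (auto simp: graph_hom_def underlying_def K2_def)
  have h_vert: "h v < 2" if "v \<in> verts G" for v
    using h that by (fastforce simp: graph_hom_def underlying_def K2_def)
  have f_vert: "f v < 4" if "v \<in> verts G" for v
    using h_vert[OF that] by (simp add: f_def)
  have "{f u, f v} \<in> edges crossed_C4" if e: "{u, v} \<in> edges G" for u v
    unfolding edges_crossed_C4
    using h_edge[OF e] f_vert geometric_graph_edgeD[OF G e]
    by (subst C4_edge_iff_parity) (auto simp: f_def doubleton_eq_iff)
  moreover have "crosses crossed_C4 {f x, f y} {f u, f v}" if cr: "crosses G {x, y} {u, v}" for x y u v
  proof -
    have e: "{x, y} \<in> edges G" "{u, v} \<in> edges G"
      using cr by (auto simp: crosses_def)
    have cr': "crosses G {u, v} {x, y}"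
      using cr by (simp add: crosses_sym)
    have "c {x, y} < 2" "c {u, v} < 2" "c {x, y} \<noteq> c {u, v}"
      using c cr cr' by (auto simp: thickness_edge_coloring_def edges_crossing_subgraph)
    then consider "c {x, y} = 0" "c {u, v} = 1" | "c {x, y} = 1" "c {u, v} = 0"
      by linarith
    then have "{{f x, f y}, {f u, f v}} = {{0, 1}, {2, 3}}"
    proof cases
      case 1
      \<comment> \<open>The endpoints of the edge coloured 0 lie in \<open>V 0\<close>, hence
        outside \<open>V 1\<close> by disjointness, so each edge receives one constant
        offset.\<close>
      then have "x \<notin> V 1" "y \<notin> V 1" "u \<in> V 1" "v \<in> V 1"
        using V_sub[OF cr] V_sub[OF cr'] disj by (auto simp: V_def)
      then have "{f x, f y} = {0, 1}" "{f u, f v} = {2, 3}"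
        using h_edge[OF e(1)] h_edge[OF e(2)] by (auto simp: f_def doubleton_eq_iff)
      then show ?thesis by simp
    next
      case 2
      then have "x \<in> V 1" "y \<in> V 1" "u \<notin> V 1" "v \<notin> V 1"
        using V_sub[OF cr] V_sub[OF cr'] disj by (auto simp: V_def)
      then have "{f x, f y} = {2, 3}" "{f u, f v} = {0, 1}"
        using h_edge[OF e(1)] h_edge[OF e(2)] by (auto simp: f_def doubleton_eq_iff)
      then show ?thesis by (simp add: insert_commute)
    qed
    then show ?thesis
      by (simp add: crosses_crossed_C4_iff)
  qed
  ultimately have "geom_hom f G crossed_C4"
    using f_vert by (auto simp: geom_hom_def graph_hom_def verts_crossed_C4)
  then show ?thesis by blast
qed

theorem theorem2:
  fixes G :: "'a geom_graph"
  assumes "geometric_graph G"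
  shows "geocolorable C4 G \<longleftrightarrow>
    (\<exists>h. graph_hom h (underlying G) K2) \<and>
    (\<exists>c. thickness_edge_coloring 2 (crossing_subgraph G) c \<and>
         verts (monochromatic_subgraph (crossing_subgraph G) c 0) \<inter>
         verts (monochromatic_subgraph (crossing_subgraph G) c 1) = {})"
  unfolding geocolorable_C4_iff
  using bipartite_if_hom_crossed_C4[OF assms] coloring_if_hom_crossed_C4[OF assms]
    hom_crossed_C4_if_coloring[OF assms]
  by blast

end
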